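(* Let $\mathcal H$ be a set of functions $\mathbf h=(h_1,\dots,h_c)$ mapping $\mathcal X$ to $\mathbb R^c$. Assume that for all $i=1,\dots,m$, $\Psi_i:\mathbb R^c\to\mathbb R$ is $\mu_i$-Lipschitz for $\mathbb R^c$ equipped with the 2-norm, that is, $|\Psi_i(\mathbf x')-\Psi_i(\mathbf x)|\le\mu_i\|\mathbf x'-\mathbf x\|_2$ for all $(\mathbf x,\mathbf x')\in(\mathbb R^c)^2$. Then, for any sample $S$ of $m$ points $x_1,\dots,x_m\in\mathcal X$, $$\frac1m\,\mathbb E_{\sigma}\Big[\sup_{\mathbf h\in\mathcal H}\sum_{i=1}^m\sigma_i\Psi_i(\mathbf h(x_i))\Big]\le\frac{\sqrt2}{m}\,\mathbb E_{\epsilon}\Big[\sup_{\mathbf h\in\mathcal H}\sum_{i=1}^m\sum_{j=1}^c\epsilon_{ij}\,\mu_i\,h_j(x_i)\Big],$$ where $\sigma=(\sigma_i)_{i}$ and $\epsilon=(\epsilon_{ij})_{i,j}$ consist of independent Rademacher variables uniformly distributed over $\{\pm1\}$. *)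

theory Defs
  imports "HOL-Probability.Probability"
begin

definition rademacher_pmf :: "real pmf" where
  "rademacher_pmf = pmf_of_set {- 1, 1}"

text \<open>
  Joint law of a family of independent Rademacher variables indexed by the finite set \<open>I\<close>.
  Elements are functions on the whole index type; outside \<open>I\<close> they take the dummy value \<open>0\<close>.
\<close>

definition rademacher_vector :: "'i set \<Rightarrow> ('i \<Rightarrow> real) pmf" where
  "rademacher_vector I = Pi_pmf I 0 (\<lambda>_. rademacher_pmf)"

text \<open>
  No boundedness is imposed on the function class, so suprema are taken in the extended reals,
  whereas the library's Bochner expectation is restricted to vector-space-valued functions.
  Expectations of extended-real variables are the usual \<open>E f\<^sup>+ - E f\<^sup>-\<close>
  (\<open>e2ennreal\<close> sends negative values to \<open>0\<close>). As \<open>\<infinity> - \<infinity> = \<infinity>\<close> in \<open>ereal\<close>, the value is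
  meaningful only if one of the two parts is finite. This is always the case for a supremum over
  a function class of sums weighted by finitely many random signs: it never takes the
  value \<open>-\<infinity>\<close> if the class is nonempty, and is constantly \<open>-\<infinity>\<close> otherwise.
\<close>

definition ereal_expectation :: "'a measure \<Rightarrow> ('a \<Rightarrow> ereal) \<Rightarrow> ereal" where
  "ereal_expectation M f =
     enn2ereal (\<integral>\<^sup>+ \<omega>. e2ennreal (f \<omega>) \<partial>M) - enn2ereal (\<integral>\<^sup>+ \<omega>. e2ennreal (- f \<omega>) \<partial>M)"

lemma ereal_expectation_integrable:
  assumes "integrable M f"
  shows "ereal_expectation M (\<lambda>\<omega>. ereal (f \<omega>)) = ereal (integral\<^sup>L M f)"
proof -
  have fin: "(\<integral>\<^sup>+ x. ennreal (f x) \<partial>M) < \<infinity>" "(\<integral>\<^sup>+ x. ennreal (- f x) \<partial>M) < \<infinity>"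
    using assms unfolding real_integrable_def by (auto simp: less_top)
  have conv: "enn2ereal a = ereal (enn2real a)" if "a < \<infinity>" for a
    using that by (cases a) auto
  show ?thesis
    unfolding ereal_expectation_def real_lebesgue_integral_def[OF assms]
    using conv[OF fin(1)] conv[OF fin(2)] by (simp flip: ennreal.rep_eq add: e2ennreal_ereal)
qed

end

theory Submission
  imports Defs
begin

text \<open>
  The signs \<open>\<sigma>\<^sub>i\<close> are replaced one at a time by the vectors \<open>(\<epsilon>\<^sub>i\<^sub>j)\<^sub>j\<close>. Averaging over a single sign
  produces a supremum over pairs \<open>h, h'\<close> involving \<open>\<Psi>\<^sub>i (h x\<^sub>i) - \<Psi>\<^sub>i (h' x\<^sub>i)\<close>, at most
  \<open>\<mu>\<^sub>i \<parallel>h x\<^sub>i - h' x\<^sub>i\<parallel>\<close>, and the Khintchine inequality with Szarek's constant \<open>sqrt 2\<close> bounds this by a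
  mean of \<open>\<bar>\<Sum>\<^sub>j \<epsilon>\<^sub>i\<^sub>j (h - h')\<^sub>j\<bar>\<close>. The absolute value disappears since the rest is symmetric in the pair.

  Khintchine's inequality is proved following Latala and Oleszkiewicz. For \<open>f = \<bar>\<Sum>\<^sub>i e\<^sub>i v\<^sub>i\<bar>\<close> the
  triangle inequality bounds the Dirichlet energy of \<open>f\<close> by its second moment. As \<open>f\<close> is even, its
  spectrum has no part of degree one, so the energy is also at least twice the variance; hence
  \<open>E f\<^sup>2 \<le> 2 (E f)\<^sup>2\<close>.

  Function classes are first taken finite. An arbitrary class is reduced to finite ones by choosing a
  near-maximiser for each of the finitely many sign patterns.
\<close>

section \<open>Means over independent random signs\<close>

lemma expectation_bind_pmf_finite:
  fixes f :: "'b \<Rightarrow> real"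
  assumes "finite (set_pmf p)" "\<And>x. x \<in> set_pmf p \<Longrightarrow> finite (set_pmf (q x))"
  shows "measure_pmf.expectation (p \<bind> q) f =
    measure_pmf.expectation p (\<lambda>x. measure_pmf.expectation (q x) f)"
proof -
  have "measure_pmf.expectation (p \<bind> q) f =
      (\<Sum>a\<in>set_pmf p. pmf p a *\<^sub>R measure_pmf.expectation (q a) f)"
    by (rule pmf_expectation_bind) (use assms in auto)
  also have "\<dots> = measure_pmf.expectation p (\<lambda>x. measure_pmf.expectation (q x) f)"
    by (rule integral_measure_pmf[symmetric]) (use assms in auto)
  finally show ?thesis .
qed

text \<open>For finite \<open>A\<close> the law has finite support, so every function is integrable
  and the rules below carry no integrability premises.\<close>

definition rmean :: "'i set \<Rightarrow> (('i \<Rightarrow> real) \<Rightarrow> real) \<Rightarrow> real" where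
  "rmean A f = measure_pmf.expectation (rademacher_vector A) f"

lemma set_rademacher_pmf: "set_pmf rademacher_pmf = {-1, 1}"
  by (simp add: rademacher_pmf_def)

lemma finite_set_rademacher_vector:
  "finite A \<Longrightarrow> finite (set_pmf (rademacher_vector A))"
  unfolding rademacher_vector_def by (auto intro!: finite_subset[OF set_Pi_pmf_subset'] simp: finite_PiE_dflt set_rademacher_pmf)

lemma integrable_rademacher_vector:
  fixes f :: "_ \<Rightarrow> real"
  shows "finite A \<Longrightarrow> integrable (measure_pmf (rademacher_vector A)) f"
  by (intro integrable_measure_pmf_finite finite_set_rademacher_vector)

lemma rmean_empty [simp]: "rmean {} f = f (\<lambda>_. 0)"
  by (simp add: rmean_def rademacher_vector_def)

lemma rmean_const [simp]: "rmean A (\<lambda>_. c) = c"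
  by (simp add: rmean_def)

lemma rmean_cmult [simp]: "rmean A (\<lambda>e. c * f e) = c * rmean A f"
  by (simp add: rmean_def)

lemma rmean_divide [simp]: "rmean A (\<lambda>e. f e / c) = rmean A f / c"
  by (simp add: rmean_def)

lemma rmean_minus [simp]: "rmean A (\<lambda>e. - f e) = - rmean A f"
  by (simp add: rmean_def)

lemma rmean_add: "finite A \<Longrightarrow> rmean A (\<lambda>e. f e + g e) = rmean A f + rmean A g"
  unfolding rmean_def by (intro Bochner_Integration.integral_add integrable_rademacher_vector)

lemma rmean_diff: "finite A \<Longrightarrow> rmean A (\<lambda>e. f e - g e) = rmean A f - rmean A g"
  unfolding rmean_def by (intro Bochner_Integration.integral_diff integrable_rademacher_vector)

lemma rmean_sum: "finite A \<Longrightarrow> rmean A (\<lambda>e. \<Sum>i\<in>I. f i e) = (\<Sum>i\<in>I. rmean A (f i))"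
  unfolding rmean_def by (intro Bochner_Integration.integral_sum integrable_rademacher_vector)

lemma rmean_mono: "finite A \<Longrightarrow> (\<And>e. f e \<le> g e) \<Longrightarrow> rmean A f \<le> rmean A g"
  unfolding rmean_def by (intro integral_mono integrable_rademacher_vector)

lemma rmean_nonneg: "(\<And>e. 0 \<le> f e) \<Longrightarrow> 0 \<le> rmean A f"
  unfolding rmean_def by (rule Bochner_Integration.integral_nonneg)

text \<open>Fubini for two independent blocks of signs.\<close>

lemma rmean_union:
  assumes "finite A" "finite B" "A \<inter> B = {}"
  shows "rmean (A \<union> B) f = rmean A (\<lambda>s. rmean B (\<lambda>t. f (\<lambda>i. if i \<in> A then s i else t i)))"
proof -
  let ?F = "\<lambda>s t i. if i \<in> A then s i else t i"
  have "rademacher_vector (A \<union> B) =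
      rademacher_vector A \<bind> (\<lambda>s. rademacher_vector B \<bind> (\<lambda>t. return_pmf (?F s t)))"
    unfolding rademacher_vector_def Pi_pmf_union[OF assms]
    by (simp add: map_pmf_def pair_pmf_def bind_assoc_pmf bind_return_pmf)
  then show ?thesis
    unfolding rmean_def by (simp add: expectation_bind_pmf_finite finite_set_rademacher_vector assms)
qed

lemma rmean_insert:
  assumes "finite A" "a \<notin> A"
  shows "rmean (insert a A) f =
    (rmean A (\<lambda>e. f (e(a := 1))) + rmean A (\<lambda>e. f (e(a := -1)))) / 2"
proof -
  have "rademacher_vector (insert a A) =
      rademacher_pmf \<bind> (\<lambda>s. map_pmf (\<lambda>e. e(a := s)) (rademacher_vector A))"
    unfolding rademacher_vector_def Pi_pmf_insert[OF assms]
    by (simp add: map_pmf_def pair_pmf_def bind_assoc_pmf bind_return_pmf)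
  then show ?thesis
    unfolding rmean_def rademacher_pmf_def
    by (simp add: pmf_expectation_bind_pmf_of_set finite_set_rademacher_vector assms divide_simps)
qed

text \<open>Negation swaps the two branches of \<open>rmean_insert\<close>. The base case works
  because the dummy value 0 is its own negative.\<close>

lemma rmean_uminus_arg:
  assumes "finite A"
  shows "rmean A (\<lambda>e. f (\<lambda>i. - e i)) = rmean A f"
  using assms
proof (induction A arbitrary: f rule: finite_induct)
  case (insert a A)
  have *: "(\<lambda>i. - (e(a := s)) i) = (\<lambda>i. - e i)(a := - s)" for e :: "'a \<Rightarrow> real" and s
    by auto
  show ?case
    unfolding rmean_insert[OF insert.hyps] *
    using insert.IH[of "\<lambda>e. f (e(a := 1))"] insert.IH[of "\<lambda>e. f (e(a := -1))"] by simp
qed simp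

lemma rmean_flip:
  assumes "finite A" "a \<in> A"
  shows "rmean A (\<lambda>e. f (e(a := - e a))) = rmean A f"
proof -
  obtain B where "A = insert a B" "a \<notin> B"
    using mk_disjoint_insert[OF assms(2)] by auto
  with assms(1) show ?thesis
    by (simp add: rmean_insert)
qed

section \<open>Poincare inequalities on the discrete cube\<close>

definition cube_energy :: "'i set \<Rightarrow> (('i \<Rightarrow> real) \<Rightarrow> real) \<Rightarrow> real" where
  "cube_energy A f = (\<Sum>i\<in>A. rmean A (\<lambda>e. (f e - f (e(i := - e i)))\<^sup>2)) / 4"

text \<open>In Walsh terms, the squared norm of the degree-one part of \<open>f\<close>.\<close>

definition level1_weight :: "'i set \<Rightarrow> (('i \<Rightarrow> real) \<Rightarrow> real) \<Rightarrow> real" where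
  "level1_weight A f = (\<Sum>i\<in>A. (rmean A (\<lambda>e. e i * f e))\<^sup>2)"

text \<open>Splitting in the coordinate \<open>a\<close>: \<open>f\<close> is \<open>g\<close> plus
  the sign at \<open>a\<close> times \<open>h\<close>, where neither \<open>g\<close> nor
  \<open>h\<close> depends on that sign.\<close>

context
  fixes A :: "'i set" and a :: 'i and f g h :: "('i \<Rightarrow> real) \<Rightarrow> real"
  assumes A: "finite A" "a \<notin> A"
  defines "g \<equiv> \<lambda>e. (f (e(a := 1)) + f (e(a := -1))) / 2"
  defines "h \<equiv> \<lambda>e. (f (e(a := 1)) - f (e(a := -1))) / 2"
begin

lemma upd_eq_even_odd: "f (e(a := 1)) = g e + h e" "f (e(a := -1)) = g e - h e"
  by (simp_all add: g_def h_def field_simps)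

lemma rmean_insert_split: "rmean (insert a A) f = rmean A g"
  unfolding rmean_insert[OF A] upd_eq_even_odd by (simp add: rmean_add rmean_diff A)

lemma rmean_square_insert:
  "rmean (insert a A) (\<lambda>e. (f e)\<^sup>2) = rmean A (\<lambda>e. (g e)\<^sup>2) + rmean A (\<lambda>e. (h e)\<^sup>2)"
  unfolding rmean_insert[OF A] upd_eq_even_odd
  by (simp add: power2_sum power2_diff rmean_add rmean_diff A)

text \<open>Flipping \<open>a\<close> changes \<open>f\<close> by \<open>2 * h\<close> up to sign,
  which gives the last term. For the other coordinates, averaging over the sign at \<open>a\<close>
  cancels the products of increments of \<open>g\<close> and \<open>h\<close>.\<close>

lemma cube_energy_insert:
  "cube_energy (insert a A) f = cube_energy A g + cube_energy A h + rmean A (\<lambda>e. (h e)\<^sup>2)"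
proof -
  have 1: "rmean (insert a A) (\<lambda>e. (f e - f (e(a := - e a)))\<^sup>2) = 4 * rmean A (\<lambda>e. (h e)\<^sup>2)"
    by (simp add: rmean_insert[OF A] upd_eq_even_odd power_mult_distrib)
  have 2: "rmean (insert a A) (\<lambda>e. (f e - f (e(i := - e i)))\<^sup>2) =
      rmean A (\<lambda>e. (g e - g (e(i := - e i)))\<^sup>2) + rmean A (\<lambda>e. (h e - h (e(i := - e i)))\<^sup>2)"
    (is "_ = rmean A ?G + rmean A ?H") if "i \<in> A" for i
  proof -
    have "i \<noteq> a" using that A by auto
    then have upd: "e(a := s, i := t) = e(i := t, a := s)" for e :: "'i \<Rightarrow> real" and s t
      by (simp add: fun_upd_twist)
    have "rmean (insert a A) (\<lambda>e. (f e - f (e(i := - e i)))\<^sup>2) =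
        (rmean A (\<lambda>e. ((g e - g (e(i := - e i))) + (h e - h (e(i := - e i))))\<^sup>2) +
         rmean A (\<lambda>e. ((g e - g (e(i := - e i))) - (h e - h (e(i := - e i))))\<^sup>2)) / 2"
      using \<open>i \<noteq> a\<close> by (simp add: rmean_insert[OF A] upd upd_eq_even_odd algebra_simps)
    also have "\<dots> = rmean A ?G + rmean A ?H"
      unfolding power2_sum power2_diff[of "g e - g _" "h e - h _" for e]
      by (simp only: rmean_add rmean_diff A rmean_cmult) simp
    finally show ?thesis .
  qed
  show ?thesis
    using A 1 2 by (simp add: cube_energy_def sum.distrib field_simps)
qed

text \<open>Averaging over the sign at \<open>a\<close> removes \<open>g\<close> from the
  coefficient at \<open>a\<close> and \<open>h\<close> from all the others.\<close>

lemma level1_weight_insert: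
  "level1_weight (insert a A) f = level1_weight A g + (rmean A h)\<^sup>2"
proof -
  have 1: "rmean (insert a A) (\<lambda>e. e a * f e) = rmean A h"
    by (simp add: rmean_insert[OF A] upd_eq_even_odd rmean_add rmean_diff A)
  have 2: "rmean (insert a A) (\<lambda>e. e i * f e) = rmean A (\<lambda>e. e i * g e)" if "i \<in> A" for i
  proof -
    have "i \<noteq> a" using that A by auto
    then show ?thesis
      by (simp add: rmean_insert[OF A] upd_eq_even_odd rmean_add rmean_diff A ring_distribs)
  qed
  show ?thesis
    using A 1 2 by (simp add: level1_weight_def)
qed

end

text \<open>Induction on the coordinates: the second moment of \<open>?h\<close> occurs on both
  sides, the energy of \<open>?h\<close> is nonnegative, and the induction hypothesis treats
  \<open>?g\<close>.\<close>

lemma poincare_cube: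
  assumes "finite A"
  shows "rmean A (\<lambda>e. (f e)\<^sup>2) - (rmean A f)\<^sup>2 \<le> cube_energy A f"
  using assms
proof (induction A arbitrary: f rule: finite_induct)
  case (insert a A)
  let ?g = "\<lambda>e. (f (e(a := 1)) + f (e(a := -1))) / 2"
  let ?h = "\<lambda>e. (f (e(a := 1)) - f (e(a := -1))) / 2"
  have "0 \<le> cube_energy A ?h"
    unfolding cube_energy_def by (intro divide_nonneg_pos sum_nonneg rmean_nonneg) auto
  with insert.IH[of ?g] show ?case
    unfolding rmean_insert_split[OF insert.hyps, where f = f] rmean_square_insert[OF insert.hyps, where f = f]
      cube_energy_insert[OF insert.hyps, where f = f] by linarith
qed (simp add: cube_energy_def)

text \<open>
  In Walsh coefficients, \<open>cube_energy\<close> is \<open>\<Sum>\<^sub>S card S * (coeff\<^sub>S)\<^sup>2\<close> and the variance is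
  \<open>\<Sum>\<^sub>S (coeff\<^sub>S)\<^sup>2\<close> over nonempty \<open>S\<close>, so only the sets of size one can violate the factor two.
\<close>

lemma poincare_cube_level1:
  assumes "finite A"
  shows "2 * (rmean A (\<lambda>e. (f e)\<^sup>2) - (rmean A f)\<^sup>2) \<le> cube_energy A f + level1_weight A f"
  using assms
proof (induction A arbitrary: f rule: finite_induct)
  case (insert a A)
  define g where "g = (\<lambda>e. (f (e(a := 1)) + f (e(a := -1))) / 2)"
  define h where "h = (\<lambda>e. (f (e(a := 1)) - f (e(a := -1))) / 2)"
  have "rmean (insert a A) f = rmean A g"
    and "rmean (insert a A) (\<lambda>e. (f e)\<^sup>2) = rmean A (\<lambda>e. (g e)\<^sup>2) + rmean A (\<lambda>e. (h e)\<^sup>2)"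
    and "cube_energy (insert a A) f = cube_energy A g + cube_energy A h + rmean A (\<lambda>e. (h e)\<^sup>2)"
    and "level1_weight (insert a A) f = level1_weight A g + (rmean A h)\<^sup>2"
    unfolding g_def h_def
    by (rule rmean_insert_split rmean_square_insert cube_energy_insert level1_weight_insert; fact)+
  \<comment> \<open>After the induction hypothesis for \<open>g\<close>, what remains is that the
    variance of \<open>h\<close> is at most its energy, the plain Poincare inequality.\<close>
  then show ?case
    using insert.IH[of g] poincare_cube[OF insert.hyps(1), of h] by simp
qed (simp add: cube_energy_def level1_weight_def)

section \<open>Khintchine's inequality with constant sqrt 2\<close>

lemma rmean_square_linear:
  assumes "finite A"
  shows "rmean A (\<lambda>e. (c + (\<Sum>i\<in>A. e i * v i))\<^sup>2) = c\<^sup>2 + (\<Sum>i\<in>A. (v i)\<^sup>2)"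
  using assms
proof (induction A arbitrary: c rule: finite_induct)
  case (insert a A)
  have *: "(\<Sum>i\<in>A. (e(a := s)) i * v i) = (\<Sum>i\<in>A. e i * v i)" for e :: "'a \<Rightarrow> real" and s
    using insert.hyps by (intro sum.cong) auto
  \<comment> \<open>The two values of the new sign shift \<open>c\<close> by \<open>v a\<close> and
    \<open>- v a\<close>; this is why the statement carries a shift.\<close>
  have "rmean (insert a A) (\<lambda>e. (c + (\<Sum>i\<in>insert a A. e i * v i))\<^sup>2) =
      (rmean A (\<lambda>e. ((c + v a) + (\<Sum>i\<in>A. e i * v i))\<^sup>2) +
       rmean A (\<lambda>e. ((c - v a) + (\<Sum>i\<in>A. e i * v i))\<^sup>2)) / 2"
    by (simp only: rmean_insert[OF insert.hyps] sum.insert[OF insert.hyps] * fun_upd_same)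
      (simp add: algebra_simps)
  also have "\<dots> = c\<^sup>2 + (\<Sum>i\<in>insert a A. (v i)\<^sup>2)"
    unfolding insert.IH using insert.hyps by (simp add: power2_sum power2_diff)
  finally show ?case .
qed simp

text \<open>Summed over all single flips, the linear form reproduces itself with factor n - 2, where
  n is \<open>card A\<close>. The triangle inequality then bounds the sum of the flipped
  \<open>f\<close> below by (n - 2) \<open>f\<close>, and expanding the energy leaves the constant
  (n - (n - 2)) / 2 = 1.\<close>

lemma cube_energy_abs_linear_le:
  fixes v :: "'i \<Rightarrow> real"
  assumes "finite A"
  defines "f \<equiv> \<lambda>e. \<bar>\<Sum>i\<in>A. e i * v i\<bar>"
  shows "cube_energy A f \<le> rmean A (\<lambda>e. (f e)\<^sup>2)"
proof -
  let ?n = "real (card A)"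
  have flip: "(\<Sum>i\<in>A. (e(k := - e k)) i * v i) = (\<Sum>i\<in>A. e i * v i) - 2 * (e k * v k)"
    if "k \<in> A" for e k
  proof -
    have "(\<Sum>i\<in>A. (e(k := - e k)) i * v i) = (\<Sum>i\<in>A. e i * v i - (if i = k then 2 * (e k * v k) else 0))"
      by (intro sum.cong) auto
    then show ?thesis
      using that assms(1) by (simp add: sum_subtractf)
  qed
  have lower: "(?n - 2) * f e \<le> (\<Sum>k\<in>A. f (e(k := - e k)))" for e
  proof -
    \<comment> \<open>With fewer than two coordinates the factor is negative, and the bound still
      holds.\<close>
    have "(?n - 2) * f e \<le> \<bar>(?n - 2) * (\<Sum>i\<in>A. e i * v i)\<bar>"
      unfolding f_def abs_mult by (intro mult_right_mono) auto
    also have "(?n - 2) * (\<Sum>i\<in>A. e i * v i) = (\<Sum>k\<in>A. (\<Sum>i\<in>A. (e(k := - e k)) i * v i))"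
    proof -
      have "(\<Sum>k\<in>A. (\<Sum>i\<in>A. (e(k := - e k)) i * v i)) =
          (\<Sum>k\<in>A. (\<Sum>i\<in>A. e i * v i) - 2 * (e k * v k))"
        by (intro sum.cong refl flip)
      then show ?thesis
        by (simp add: sum_subtractf left_diff_distrib flip: sum_distrib_left)
    qed
    also have "\<bar>\<dots>\<bar> \<le> (\<Sum>k\<in>A. f (e(k := - e k)))"
      unfolding f_def by (rule sum_abs)
    finally show ?thesis .
  qed
  have cross: "rmean A (\<lambda>e. f e * (\<Sum>k\<in>A. f (e(k := - e k)))) =
      (\<Sum>k\<in>A. rmean A (\<lambda>e. f e * f (e(k := - e k))))"
    by (simp only: sum_distrib_left rmean_sum[OF assms(1)])
  \<comment> \<open>Both squares have the same mean because the law is invariant under a single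
    flip.\<close>
  have "rmean A (\<lambda>e. (f e - f (e(k := - e k)))\<^sup>2) =
      2 * rmean A (\<lambda>e. (f e)\<^sup>2) - 2 * rmean A (\<lambda>e. f e * f (e(k := - e k)))" if "k \<in> A" for k
    using rmean_flip[OF assms(1) that, of "\<lambda>e. (f e)\<^sup>2"]
    by (simp add: power2_diff rmean_add rmean_diff assms(1) mult.assoc)
  then have "cube_energy A f =
      (?n * rmean A (\<lambda>e. (f e)\<^sup>2) - rmean A (\<lambda>e. f e * (\<Sum>k\<in>A. f (e(k := - e k))))) / 2"
    by (simp add: cube_energy_def sum_subtractf cross diff_divide_distrib del: fun_upd_apply
        flip: sum_distrib_left)
  moreover have "rmean A (\<lambda>e. (?n - 2) * (f e)\<^sup>2) \<le> rmean A (\<lambda>e. f e * (\<Sum>k\<in>A. f (e(k := - e k))))"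
  proof (rule rmean_mono[OF assms(1)])
    show "(?n - 2) * (f e)\<^sup>2 \<le> f e * (\<Sum>k\<in>A. f (e(k := - e k)))" for e
      using mult_left_mono[OF lower[of e], of "f e"]
      by (simp add: f_def power2_eq_square mult_ac del: fun_upd_apply abs_mult_self_eq)
  qed
  ultimately show ?thesis
    unfolding rmean_cmult by (simp add: algebra_simps)
qed

lemma khintchine_l1_l2:
  assumes "finite A"
  shows "sqrt (\<Sum>i\<in>A. (v i)\<^sup>2) \<le> sqrt 2 * rmean A (\<lambda>e. \<bar>\<Sum>i\<in>A. e i * v i\<bar>)"
proof -
  let ?f = "\<lambda>e. \<bar>\<Sum>i\<in>A. e i * v i\<bar>"
  \<comment> \<open>Negating all signs preserves the law and \<open>?f\<close> but negates
    \<open>e k\<close>, so this mean equals its own negative.\<close>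
  have "rmean A (\<lambda>e. e k * ?f e) = 0" for k
    using rmean_uminus_arg[OF assms, of "\<lambda>e. e k * ?f e"] by (simp add: sum_negf)
  then have "level1_weight A ?f = 0"
    by (simp add: level1_weight_def)
  \<comment> \<open>The two energy bounds combine to 2 (E f^2 - (E f)^2) \<le> E f^2.\<close>
  then have "rmean A (\<lambda>e. (?f e)\<^sup>2) \<le> 2 * (rmean A ?f)\<^sup>2"
    using poincare_cube_level1[OF assms, of ?f] cube_energy_abs_linear_le[OF assms, of v] by simp
  moreover have "rmean A (\<lambda>e. (?f e)\<^sup>2) = (\<Sum>i\<in>A. (v i)\<^sup>2)"
    using rmean_square_linear[OF assms, of 0 v] by simp
  moreover have "0 \<le> rmean A ?f"
    by (rule rmean_nonneg) simp
  ultimately show ?thesis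
    by (intro real_le_lsqrt) (auto simp: sum_nonneg power_mult_distrib)
qed

section \<open>Replacing signs by sign vectors over a finite class\<close>

lemma max_symmetrization:
  fixes \<psi> A :: "'h \<Rightarrow> real" and w :: "'h \<Rightarrow> 'j \<Rightarrow> real"
  assumes F: "finite F" "F \<noteq> {}" and J: "finite J"
    and \<psi>: "\<And>h h'. h \<in> F \<Longrightarrow> h' \<in> F \<Longrightarrow>
      \<psi> h - \<psi> h' \<le> rmean J (\<lambda>e. \<bar>\<Sum>j\<in>J. e j * (w h j - w h' j)\<bar>)"
  shows "((MAX h\<in>F. A h + \<psi> h) + (MAX h\<in>F. A h - \<psi> h)) / 2
    \<le> rmean J (\<lambda>e. MAX h\<in>F. A h + (\<Sum>j\<in>J. e j * w h j))"
proof -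
  let ?u = "\<lambda>e h. \<Sum>j\<in>J. e j * w h j"
  let ?M = "\<lambda>e. MAX h\<in>F. A h + ?u e h"
  \<comment> \<open>With \<open>h1\<close> and \<open>h2\<close> attaining the two maxima, the sum
    involves \<open>\<psi>\<close> only through \<open>\<psi> h1 - \<psi> h2\<close>.\<close>
  have "(MAX h\<in>F. A h + \<psi> h) \<in> (\<lambda>h. A h + \<psi> h) ` F" "(MAX h\<in>F. A h - \<psi> h) \<in> (\<lambda>h. A h - \<psi> h) ` F"
    using F by (auto intro!: Max_in)
  then obtain h1 h2 where h: "h1 \<in> F" "h2 \<in> F"
    and eq: "(MAX h\<in>F. A h + \<psi> h) = A h1 + \<psi> h1" "(MAX h\<in>F. A h - \<psi> h) = A h2 - \<psi> h2"
    by auto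
  have M: "A h + ?u e h \<le> ?M e" if "h \<in> F" for h e
    using that F by (intro Max_ge) auto
  have neg: "?u (\<lambda>j. - e j) h = - ?u e h" for e h
    by (simp add: sum_negf)
  have "(MAX h\<in>F. A h + \<psi> h) + (MAX h\<in>F. A h - \<psi> h)
      \<le> (A h1 + A h2) + rmean J (\<lambda>e. \<bar>\<Sum>j\<in>J. e j * (w h1 j - w h2 j)\<bar>)"
    unfolding eq using \<psi>[OF h] by simp
  also have "\<dots> = rmean J (\<lambda>e. (A h1 + A h2) + \<bar>?u e h1 - ?u e h2\<bar>)"
    by (simp add: rmean_add J right_diff_distrib sum_subtractf)
  \<comment> \<open>Pairing \<open>h1\<close> with \<open>e\<close> and \<open>h2\<close> with
    \<open>- e\<close> covers one sign inside the absolute value; the exchanged pairing covers the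
    other.\<close>
  also have "\<dots> \<le> rmean J (\<lambda>e. ?M e + ?M (\<lambda>j. - e j))"
  proof (rule rmean_mono[OF J])
    fix e
    show "A h1 + A h2 + \<bar>?u e h1 - ?u e h2\<bar> \<le> ?M e + ?M (\<lambda>j. - e j)"
      using M[OF h(1), of e] M[OF h(2), of e] M[OF h(1), of "\<lambda>j. - e j"] M[OF h(2), of "\<lambda>j. - e j"]
      unfolding neg by linarith
  qed
  also have "\<dots> = 2 * rmean J ?M"
    using rmean_uminus_arg[OF J, of ?M] by (simp add: rmean_add J)
  finally show ?thesis
    by simp
qed

text \<open>Induction over the signs. The free offset \<open>A\<close> absorbs the terms not under
  treatment: first \<open>\<psi> a\<close> with either sign, then the terms already replaced.
  Disjointness of the blocks makes their signs independent.\<close>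

lemma max_contraction:
  fixes \<psi> :: "'i \<Rightarrow> 'h \<Rightarrow> real" and w :: "'h \<Rightarrow> 'j \<Rightarrow> real"
  assumes I: "finite I" and F: "finite F" "F \<noteq> {}"
    and J: "\<And>i. i \<in> I \<Longrightarrow> finite (J i)" "disjoint_family_on J I"
    and \<psi>: "\<And>i h h'. i \<in> I \<Longrightarrow> h \<in> F \<Longrightarrow> h' \<in> F \<Longrightarrow>
      \<psi> i h - \<psi> i h' \<le> rmean (J i) (\<lambda>e. \<bar>\<Sum>j\<in>J i. e j * (w h j - w h' j)\<bar>)"
  shows "rmean I (\<lambda>s. MAX h\<in>F. A h + (\<Sum>i\<in>I. s i * \<psi> i h))
    \<le> rmean (\<Union>i\<in>I. J i) (\<lambda>e. MAX h\<in>F. A h + (\<Sum>i\<in>I. \<Sum>j\<in>J i. e j * w h j))"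
  using I J \<psi>
proof (induction I arbitrary: A rule: finite_induct)
  case (insert a I)
  let ?U = "\<Union>i\<in>I. J i"
  let ?S = "\<lambda>e h. \<Sum>i\<in>I. \<Sum>j\<in>J i. e j * w h j"
  have fin: "finite ?U" "finite (J a)" and disj: "?U \<inter> J a = {}"
    using insert.prems insert.hyps by (auto simp: disjoint_family_on_def)
  have IH: "rmean I (\<lambda>s. MAX h\<in>F. B h + (\<Sum>i\<in>I. s i * \<psi> i h))
      \<le> rmean ?U (\<lambda>e. MAX h\<in>F. B h + ?S e h)" for B
    using insert.prems by (intro insert.IH) (auto simp: disjoint_family_on_def)
  have *: "(\<Sum>i\<in>I. (e(a := s)) i * \<psi> i h) = (\<Sum>i\<in>I. e i * \<psi> i h)" for e :: "'i \<Rightarrow> real" and s h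
    using insert.hyps by (intro sum.cong) auto
  have "rmean (insert a I) (\<lambda>s. MAX h\<in>F. A h + (\<Sum>i\<in>insert a I. s i * \<psi> i h)) =
      (rmean I (\<lambda>s. MAX h\<in>F. (A h + \<psi> a h) + (\<Sum>i\<in>I. s i * \<psi> i h)) +
       rmean I (\<lambda>s. MAX h\<in>F. (A h - \<psi> a h) + (\<Sum>i\<in>I. s i * \<psi> i h))) / 2"
    by (simp only: rmean_insert[OF insert.hyps] sum.insert[OF insert.hyps] * fun_upd_same)
      (simp add: algebra_simps)
  also have "\<dots> \<le> (rmean ?U (\<lambda>e. MAX h\<in>F. (A h + \<psi> a h) + ?S e h) +
      rmean ?U (\<lambda>e. MAX h\<in>F. (A h - \<psi> a h) + ?S e h)) / 2"
    using IH[of "\<lambda>h. A h + \<psi> a h"] IH[of "\<lambda>h. A h - \<psi> a h"] by (intro divide_right_mono add_mono) auto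
  also have "\<dots> = rmean ?U (\<lambda>e. ((MAX h\<in>F. (A h + ?S e h) + \<psi> a h) + (MAX h\<in>F. (A h + ?S e h) - \<psi> a h)) / 2)"
    by (simp add: rmean_add fin algebra_simps)
  \<comment> \<open>With the signs \<open>e\<close> of the other blocks fixed, the one-sign bound
    applies with offset \<open>A h + ?S e h\<close>.\<close>
  also have "\<dots> \<le> rmean ?U (\<lambda>e. rmean (J a) (\<lambda>t. MAX h\<in>F. (A h + ?S e h) + (\<Sum>j\<in>J a. t j * w h j)))"
    using F fin insert.prems by (intro rmean_mono max_symmetrization) auto
  \<comment> \<open>The families \<open>e\<close> and \<open>t\<close> are glued into one on the
    disjoint union, the form that \<open>rmean_union\<close> expects.\<close>
  also have "\<dots> = rmean ?U (\<lambda>e. rmean (J a) (\<lambda>t.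
      (\<lambda>r. MAX h\<in>F. A h + (\<Sum>i\<in>insert a I. \<Sum>j\<in>J i. r j * w h j)) (\<lambda>j. if j \<in> ?U then e j else t j)))"
  proof -
    have 1: "(\<Sum>i\<in>I. \<Sum>j\<in>J i. (if j \<in> ?U then e j else t j) * w h j) = ?S e h" for e t :: "'j \<Rightarrow> real" and h
      by (intro sum.cong) auto
    have 2: "(\<Sum>j\<in>J a. (if j \<in> ?U then e j else t j) * w h j) = (\<Sum>j\<in>J a. t j * w h j)"
      for e t :: "'j \<Rightarrow> real" and h
      using disj by (intro sum.cong) auto
    show ?thesis
      by (simp only: sum.insert[OF insert.hyps] 1 2) (simp add: algebra_simps)
  qed
  also have "\<dots> = rmean (?U \<union> J a) (\<lambda>r. MAX h\<in>F. A h + (\<Sum>i\<in>insert a I. \<Sum>j\<in>J i. r j * w h j))"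
    by (rule rmean_union[OF fin disj, symmetric])
  also have "?U \<union> J a = (\<Union>i\<in>insert a I. J i)"
    by auto
  finally show ?case .
qed simp

section \<open>Extended-real expectations of suprema\<close>

lemma ereal_expectation_cong_pmf:
  assumes "\<And>y. y \<in> set_pmf p \<Longrightarrow> f y = g y"
  shows "ereal_expectation (measure_pmf p) f = ereal_expectation (measure_pmf p) g"
proof -
  have "(\<integral>\<^sup>+ y. e2ennreal (f y) \<partial>measure_pmf p) = (\<integral>\<^sup>+ y. e2ennreal (g y) \<partial>measure_pmf p)"
    "(\<integral>\<^sup>+ y. e2ennreal (- f y) \<partial>measure_pmf p) = (\<integral>\<^sup>+ y. e2ennreal (- g y) \<partial>measure_pmf p)"
    using assms by (auto intro!: nn_integral_cong_AE simp: AE_measure_pmf_iff)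
  then show ?thesis
    by (simp add: ereal_expectation_def)
qed

text \<open>The bound for subclasses with at most two elements makes the class pointwise bounded on
  the support; one near-maximiser for each of the finitely many outcomes then gives a finite
  subclass.\<close>

lemma ereal_expectation_SUP_le:
  fixes v :: "'h \<Rightarrow> 'a \<Rightarrow> real"
  assumes p: "finite (set_pmf p)" and H: "H \<noteq> {}"
    and C: "\<And>F. finite F \<Longrightarrow> F \<noteq> {} \<Longrightarrow> F \<subseteq> H \<Longrightarrow>
      measure_pmf.expectation p (\<lambda>y. MAX h\<in>F. v h y) \<le> C"
  shows "ereal_expectation (measure_pmf p) (\<lambda>y. SUP h\<in>H. ereal (v h y)) \<le> ereal C"
proof -
  let ?E = "measure_pmf.expectation p"
  have int: "integrable p f" for f :: "'a \<Rightarrow> real"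
    using p by (rule integrable_measure_pmf_finite)
  obtain h0 where h0: "h0 \<in> H" using H by auto
  have bdd: "bdd_above ((\<lambda>h. v h y) ` H)" if y: "y \<in> set_pmf p" for y
  proof (rule bdd_aboveI2)
    fix h assume h: "h \<in> H"
    \<comment> \<open>The left integrand is \<open>v h0\<close> except at \<open>y\<close>, where it
      is \<open>v h y\<close>. As \<open>y\<close> has positive mass, bounding the mean bounds
      \<open>v h y\<close>.\<close>
    have "?E (\<lambda>z. v h0 z + indicator {y} z * (v h y - v h0 y)) \<le> ?E (\<lambda>z. MAX k\<in>{h0, h}. v k z)"
      by (intro integral_mono int) (auto simp: indicator_def)
    also have "\<dots> \<le> C"
      using h h0 by (intro C) auto
    finally have "?E (v h0) + pmf p y * (v h y - v h0 y) \<le> C"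
      by (simp add: int Bochner_Integration.integral_add measure_pmf_single)
    then show "v h y \<le> v h0 y + (C - ?E (v h0)) / pmf p y"
      using pmf_positive[OF y] by (simp add: field_simps)
  qed
  define S where "S = (\<lambda>y. SUP h\<in>H. v h y)"
  have S: "(SUP h\<in>H. ereal (v h y)) = ereal (S y)" if y: "y \<in> set_pmf p" for y
  proof -
    obtain b where "\<And>h. h \<in> H \<Longrightarrow> v h y \<le> b"
      using bdd[OF y] by (auto simp: bdd_above_def)
    then have "(SUP h\<in>H. ereal (v h y)) \<le> ereal b"
      by (intro SUP_least) simp
    moreover have "ereal (v h0 y) \<le> (SUP h\<in>H. ereal (v h y))"
      using h0 by (rule SUP_upper)
    ultimately have "\<bar>SUP h\<in>H. ereal (v h y)\<bar> \<noteq> \<infinity>"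
      by (cases "SUP h\<in>H. ereal (v h y)") auto
    then show ?thesis
      unfolding S_def by (rule ereal_SUP[symmetric])
  qed
  have "?E S \<le> C"
  proof (rule field_le_epsilon)
    fix d :: real assume "d > 0"
    have "\<exists>h\<in>H. S y - d < v h y" if "y \<in> set_pmf p" for y
      using less_cSUP_iff[OF H bdd[OF that], of "S y - d"] \<open>d > 0\<close> by (simp add: S_def)
    then obtain k where k: "\<And>y. y \<in> set_pmf p \<Longrightarrow> k y \<in> H \<and> S y - d < v (k y) y"
      by metis
    let ?F = "k ` set_pmf p"
    have "?E (\<lambda>y. S y - d) \<le> ?E (\<lambda>y. MAX h\<in>?F. v h y)"
    proof (intro integral_mono_AE int)
      show "AE y in p. S y - d \<le> (MAX h\<in>?F. v h y)"
        unfolding AE_measure_pmf_iff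
      proof
        fix y assume y: "y \<in> set_pmf p"
        have "S y - d \<le> v (k y) y" using k[OF y] by simp
        also have "\<dots> \<le> (MAX h\<in>?F. v h y)" using y p by (intro Max_ge) auto
        finally show "S y - d \<le> (MAX h\<in>?F. v h y)" .
      qed
    qed
    also have "\<dots> \<le> C"
      using k p set_pmf_not_empty by (intro C) auto
    finally show "?E S \<le> C + d"
      by (simp add: int Bochner_Integration.integral_diff)
  qed
  moreover have "ereal_expectation p (\<lambda>y. SUP h\<in>H. ereal (v h y)) = ereal_expectation p (\<lambda>y. ereal (S y))"
    by (rule ereal_expectation_cong_pmf) (rule S)
  ultimately show ?thesis
    by (simp add: ereal_expectation_integrable int)
qed

text \<open>The positive part has infinite mean because \<open>y\<close> has positive mass, and by
  \<infinity> - \<infinity> = \<infinity> the difference is infinite whatever the negative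
  part.\<close>

lemma ereal_expectation_pmf_infty:
  assumes "y \<in> set_pmf p" "f y = \<infinity>"
  shows "ereal_expectation (measure_pmf p) f = \<infinity>"
proof -
  have "(\<integral>\<^sup>+ z. \<infinity> * indicator {y} z \<partial>measure_pmf p) \<le> (\<integral>\<^sup>+ z. e2ennreal (f z) \<partial>measure_pmf p)"
    using assms by (intro nn_integral_mono) (auto simp: indicator_def)
  moreover have "(\<integral>\<^sup>+ z. \<infinity> * indicator {y} z \<partial>measure_pmf p) = \<infinity>"
    using pmf_positive[OF assms(1)]
    by (subst nn_integral_cmult_indicator) (auto simp: emeasure_pmf_single ennreal_top_mult)
  ultimately show ?thesis
    unfolding ereal_expectation_def by (simp add: top_unique)
qed


text \<open>For an empty class, whose supremum is constantly -\<infinity>.\<close>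

lemma ereal_expectation_pmf_minus_infty: "ereal_expectation (measure_pmf p) (\<lambda>_. -\<infinity>) = -\<infinity>"
proof -
  have "e2ennreal (-\<infinity>) = 0" by (rule e2ennreal_neg) simp
  then show ?thesis
    by (simp add: ereal_expectation_def zero_ennreal.rep_eq)
qed

section \<open>The vector contraction inequality for arbitrary classes\<close>

theorem lemma5:
  fixes H :: "('x \<Rightarrow> real ^ 'c) set"
    and m :: nat
    and \<Psi> :: "nat \<Rightarrow> real ^ 'c \<Rightarrow> real"
    and \<mu> :: "nat \<Rightarrow> real"
    and x :: "nat \<Rightarrow> 'x"
  assumes "m \<ge> 1"
    and "\<And>i. i \<in> {1..m} \<Longrightarrow> (\<mu> i)-lipschitz_on UNIV (\<Psi> i)"
  shows "ereal (1 / real m) *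
           ereal_expectation (measure_pmf (rademacher_vector {1..m}))
             (\<lambda>\<sigma>. SUP h\<in>H. ereal (\<Sum>i=1..m. \<sigma> i * \<Psi> i (h (x i))))
         \<le> ereal (sqrt 2 / real m) *
           ereal_expectation (measure_pmf (rademacher_vector ({1..m} \<times> (UNIV :: 'c set))))
             (\<lambda>\<epsilon>. SUP h\<in>H. ereal (\<Sum>i=1..m. \<Sum>j\<in>UNIV. \<epsilon> (i, j) * \<mu> i * (h (x i) $ j)))"
proof (cases "H = {}")
  case True
  \<comment> \<open>As \<open>m \<ge> 1\<close>, both prefactors are positive and both sides are
    -\<infinity>.\<close>
  with assms(1) show ?thesis
    by (simp add: bot_ereal_def ereal_expectation_pmf_minus_infty)
next
  case False
  then obtain h0 where h0: "h0 \<in> H" by auto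
  define F where "F = (\<lambda>h \<sigma>. \<Sum>i=1..m. \<sigma> i * \<Psi> i (h (x i)))"
  define G where "G = (\<lambda>h \<epsilon>. \<Sum>i=1..m. \<Sum>j\<in>(UNIV :: 'c set). \<epsilon> (i, j) * \<mu> i * (h (x i) $ j))"
  let ?K = "{1..m} \<times> (UNIV :: 'c set)"
  let ?p = "rademacher_vector {1..m}" and ?q = "rademacher_vector ?K"
  let ?S = "\<lambda>\<epsilon>. SUP h\<in>H. ereal (G h \<epsilon>)"
  have "ereal (1 / real m) * ereal_expectation (measure_pmf ?p) (\<lambda>\<sigma>. SUP h\<in>H. ereal (F h \<sigma>))
      \<le> ereal (sqrt 2 / real m) * ereal_expectation (measure_pmf ?q) ?S"
  \<comment> \<open>If the right-hand supremum is infinite for some sign pattern, so is the right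
    side; otherwise its expectation is a real mean.\<close>
  proof (cases "\<exists>\<epsilon>\<in>set_pmf ?q. ?S \<epsilon> = \<infinity>")
    case True
    then have "ereal_expectation (measure_pmf ?q) ?S = \<infinity>"
      by (auto intro: ereal_expectation_pmf_infty)
    with assms(1) show ?thesis
      by simp
  next
    case finite: False
    define R where "R = (\<lambda>\<epsilon>. real_of_ereal (?S \<epsilon>))"
    \<comment> \<open>The member \<open>h0\<close> of \<open>H\<close> excludes the value
      -\<infinity>.\<close>
    have R: "?S \<epsilon> = ereal (R \<epsilon>)" if "\<epsilon> \<in> set_pmf ?q" for \<epsilon>
    proof -
      have "ereal (G h0 \<epsilon>) \<le> ?S \<epsilon>"
        using h0 by (rule SUP_upper)
      then show ?thesis
        using finite that unfolding R_def by (cases "?S \<epsilon>") auto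
    qed
    have "ereal_expectation (measure_pmf ?q) ?S = ereal_expectation (measure_pmf ?q) (\<lambda>\<epsilon>. ereal (R \<epsilon>))"
      by (rule ereal_expectation_cong_pmf) (rule R)
    also have "\<dots> = ereal (rmean ?K R)"
      unfolding rmean_def by (intro ereal_expectation_integrable integrable_rademacher_vector) simp
    finally have rhs: "ereal_expectation (measure_pmf ?q) ?S = ereal (rmean ?K R)" .
    have "ereal_expectation (measure_pmf ?p) (\<lambda>\<sigma>. SUP h\<in>H. ereal (F h \<sigma>))
        \<le> ereal (sqrt 2 * rmean ?K R)"
    proof (rule ereal_expectation_SUP_le)
      show "finite (set_pmf ?p)"
        by (simp add: finite_set_rademacher_vector)
      fix H0 assume H0: "finite H0" "H0 \<noteq> {}" "H0 \<subseteq> H"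
      \<comment> \<open>Block \<open>?J i\<close> indexes the signs replacing the i-th one. The
        weights \<open>w\<close> carry \<open>\<mu> i\<close> and Khintchine's
        \<open>sqrt 2\<close>, so that \<open>max_contraction\<close> applies.\<close>
      let ?J = "\<lambda>i. {i} \<times> (UNIV :: 'c set)"
      define w where "w = (\<lambda>(h :: 'x \<Rightarrow> real ^ 'c) (i, j). sqrt 2 * \<mu> i * (h (x i) $ j))"
      have sumJ: "(\<Sum>k\<in>?J i. f k) = (\<Sum>j\<in>UNIV. f (i, j))" for i and f :: "nat \<times> 'c \<Rightarrow> real"
        by (rule sum.reindex_bij_witness[of _ "Pair i" snd]) auto
      have lip: "\<Psi> i (h (x i)) - \<Psi> i (h' (x i))
          \<le> rmean (?J i) (\<lambda>e. \<bar>\<Sum>k\<in>?J i. e k * (w h k - w h' k)\<bar>)" if i: "i \<in> {1..m}" for i h h'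
      proof -
        let ?v = "\<lambda>k. h (x i) $ snd k - h' (x i) $ snd k"
        have mu: "0 \<le> \<mu> i"
          using assms(2)[OF i] by (rule lipschitz_on_nonneg)
        have "\<Psi> i (h (x i)) - \<Psi> i (h' (x i)) \<le> \<mu> i * dist (h (x i)) (h' (x i))"
          using lipschitz_onD[OF assms(2)[OF i], of "h (x i)" "h' (x i)"] by (simp add: dist_real_def)
        also have "dist (h (x i)) (h' (x i)) = sqrt (\<Sum>k\<in>?J i. (?v k)\<^sup>2)"
          unfolding sumJ by (simp add: dist_norm norm_vec_def L2_set_def)
        \<comment> \<open>Khintchine's inequality for the coordinate differences;
          \<open>0 \<le> \<mu> i\<close> then lets the factor enter the absolute value.\<close>
        also have "\<mu> i * \<dots> \<le> \<mu> i * (sqrt 2 * rmean (?J i) (\<lambda>e. \<bar>\<Sum>k\<in>?J i. e k * ?v k\<bar>))"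
          using mu by (intro mult_left_mono khintchine_l1_l2) auto
        also have "\<dots> = rmean (?J i) (\<lambda>e. \<mu> i * sqrt 2 * \<bar>\<Sum>k\<in>?J i. e k * ?v k\<bar>)"
          by simp
        also have "\<dots> = rmean (?J i) (\<lambda>e. \<bar>\<mu> i * sqrt 2 * (\<Sum>k\<in>?J i. e k * ?v k)\<bar>)"
          using mu by (simp only: abs_mult) simp
        also have "\<dots> = rmean (?J i) (\<lambda>e. \<bar>\<Sum>k\<in>?J i. e k * (w h k - w h' k)\<bar>)"
          unfolding sumJ sum_distrib_left by (simp add: w_def algebra_simps)
        finally show ?thesis .
      qed
      have "measure_pmf.expectation ?p (\<lambda>\<sigma>. MAX h\<in>H0. F h \<sigma>) =
          rmean {1..m} (\<lambda>\<sigma>. MAX h\<in>H0. 0 + (\<Sum>i=1..m. \<sigma> i * \<Psi> i (h (x i))))"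
        by (simp add: rmean_def F_def)
      also have "\<dots> \<le> rmean (\<Union>i\<in>{1..m}. ?J i) (\<lambda>\<epsilon>. MAX h\<in>H0. 0 + (\<Sum>i=1..m. \<Sum>k\<in>?J i. \<epsilon> k * w h k))"
        using H0 lip by (intro max_contraction) (auto simp: disjoint_family_on_def)
      also have "(\<Union>i\<in>{1..m}. ?J i) = ?K"
        by auto
      also have "(\<lambda>\<epsilon>. MAX h\<in>H0. 0 + (\<Sum>i=1..m. \<Sum>k\<in>?J i. \<epsilon> k * w h k)) = (\<lambda>\<epsilon>. MAX h\<in>H0. sqrt 2 * G h \<epsilon>)"
        unfolding sumJ by (simp add: w_def G_def sum_distrib_left mult_ac)
      \<comment> \<open>\<open>R\<close> is known to equal the supremum only on the support, hence
        the almost-everywhere comparison.\<close>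
      also have "rmean ?K \<dots> \<le> rmean ?K (\<lambda>\<epsilon>. sqrt 2 * R \<epsilon>)"
        unfolding rmean_def
      proof (intro integral_mono_AE integrable_rademacher_vector)
        show "AE \<epsilon> in ?q. (MAX h\<in>H0. sqrt 2 * G h \<epsilon>) \<le> sqrt 2 * R \<epsilon>"
          unfolding AE_measure_pmf_iff
        proof
          fix \<epsilon> assume \<epsilon>: "\<epsilon> \<in> set_pmf ?q"
          have "G h \<epsilon> \<le> R \<epsilon>" if "h \<in> H0" for h
          proof -
            have "ereal (G h \<epsilon>) \<le> ?S \<epsilon>"
              using that H0 by (intro SUP_upper) auto
            then show ?thesis
              using R[OF \<epsilon>] by simp
          qed
          then show "(MAX h\<in>H0. sqrt 2 * G h \<epsilon>) \<le> sqrt 2 * R \<epsilon>"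
            using H0 by (subst Max_le_iff) auto
        qed
      qed auto
      finally show "measure_pmf.expectation ?p (\<lambda>\<sigma>. MAX h\<in>H0. F h \<sigma>) \<le> sqrt 2 * rmean ?K R"
        by simp
    qed fact
    then have "ereal (1 / real m) * ereal_expectation (measure_pmf ?p) (\<lambda>\<sigma>. SUP h\<in>H. ereal (F h \<sigma>))
        \<le> ereal (1 / real m) * ereal (sqrt 2 * rmean ?K R)"
      by (intro ereal_mult_left_mono) auto
    also have "\<dots> = ereal (sqrt 2 / real m) * ereal_expectation (measure_pmf ?q) ?S"
      unfolding rhs by simp
    finally show ?thesis .
  qed
  then show ?thesis
    unfolding F_def G_def .
qed

end
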